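(* Let $(K,|\cdot|)$ be an algebraically closed non-archimedean valued field of characteristic $0$ with corresponding valuation $v:K\to\mathbb{R}\cup\{\infty\}$ (so $|x|$ is a decreasing function of $v(x)$, $v(0)=\infty$). Let $f(z)=z^n+a_{n-1}z^{n-1}+\cdots+a_1z+a_0\in K[z]$ be monic of degree $n\ge 2$, with $a_n=1$, such that all zeros of $f$ lie in the closed unit disk $\{x\in K: |x|\le 1\}$. Define $$I(f)=\max_{z:\,f(z)=0}\ \min_{w:\,f'(w)=0}|z-w|,$$ and $r_n=|n|^{-1/(n-1)}$. Assume $|n|<1$. Then $I(f)=r_n$ if and only if $$v(a_j)\ge \max\left\{0,\ \frac{j-1}{n-1}v(n)-v(j)\right\}\ (2\le j\le n),\qquad v(a_1)=0,\qquad v(a_0)\ge 0.$$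
   Context: A non-archimedean field is a field with an absolute value satisfying $|x+y|\le\max\{|x|,|y|\}$; the integers $n$ and $j$ are viewed as elements of $K$. It is known (and used by the paper) that $I(f)\le r_n$ always holds under these hypotheses; $I(f)=r_n$ is called "satisfying the optimal bound". *)

theory Defs
  imports
    Complex_Main
    "HOL-Library.Extended_Real"
    "HOL-Computational_Algebra.Polynomial"
begin

locale nonarch_abs =
  fixes absv :: "'a::field \<Rightarrow> real"
  assumes absv_nonneg: "0 \<le> absv x"
    and absv_eq_0_iff: "absv x = 0 \<longleftrightarrow> x = 0"
    and absv_mult: "absv (x * y) = absv x * absv y"
    and absv_add_le_max: "absv (x + y) \<le> max (absv x) (absv y)"

text \<open>
  A valuation corresponding to an absolute value is determined only up to the choice of the
  base \<open>c > 1\<close>, with \<open>absv x = c powr (- v x)\<close> for nonzero \<open>x\<close>. It takes values in the reals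
  together with \<open>\<infinity>\<close>; the element \<open>-\<infinity>\<close> of \<^typ>\<open>ereal\<close> is never attained.
\<close>

definition valuation_of :: "('a::field \<Rightarrow> ereal) \<Rightarrow> ('a \<Rightarrow> real) \<Rightarrow> bool" where
  "valuation_of v absv \<longleftrightarrow>
     (\<exists>c>1. \<forall>x. v x = (if x = 0 then \<infinity> else ereal (- log c (absv x))))"

text \<open>
  \<^const>\<open>Max\<close> and \<^const>\<open>Min\<close> are meaningful here when the polynomial has degree at least 2 over
  an algebraically closed field of characteristic 0: both sets of zeros are then finite and
  nonempty.
\<close>

definition max_min_crit_dist :: "('a::field \<Rightarrow> real) \<Rightarrow> 'a poly \<Rightarrow> real" where
  "max_min_crit_dist absv f =
     Max ((\<lambda>z. Min ((\<lambda>w. absv (z - w)) ` {w. poly (pderiv f) w = 0})) ` {z. poly f z = 0})"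

end

theory Submission
  imports Defs
begin

text \<open>
  Let \<open>r = |n|\<^sup>-\<^sup>1\<^sup>/\<^sup>(\<^sup>n\<^sup>-\<^sup>1\<^sup>)\<close>, so \<open>r > 1\<close>. The coefficients of \<open>f\<close> are integral, and
  \<open>|f'(z)| = |n| \<Prod> |z - w|\<close> over the critical points \<open>w\<close>; as \<open>|f'(z)| \<le> 1\<close> at a zero \<open>z\<close>,
  some \<open>w\<close> has \<open>|z - w| \<le> r\<close>, and if all satisfy \<open>|z - w| \<ge> r\<close> then all satisfy
  \<open>|z - w| = r\<close>, that is \<open>|w| = r\<close> because \<open>|z| \<le> 1 < r\<close>. Reading the sizes of the coefficients
  of \<open>f'\<close> off its zeros gives the stated inequalities. Conversely, the inequalities make the
  constant term \<open>a\<^sub>1\<close> dominate \<open>f'\<close> on the open disk of radius \<open>r\<close>, so that every critical point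
  satisfies \<open>|w| \<ge> r > |z|\<close> and hence \<open>|z - w| = |w| \<ge> r\<close>.
\<close>

section \<open>Ultrametric estimates for sums and polynomial values\<close>

context nonarch_abs
begin

lemma absv_0 [simp]: "absv 0 = 0"
  by (simp add: absv_eq_0_iff)

lemma absv_pos: "x \<noteq> 0 \<Longrightarrow> 0 < absv x"
  using absv_nonneg[of x] absv_eq_0_iff[of x] by linarith

lemma absv_1 [simp]: "absv 1 = 1"
  using absv_mult[of 1 1] absv_eq_0_iff[of 1] by simp

lemma absv_minus [simp]: "absv (- x) = absv x"
proof -
  have "absv (-1) * absv (-1) = 1"
    using absv_mult[of "-1" "-1"] by simp
  then have "absv (-1) = 1"
    using absv_nonneg[of "-1"] by (simp add: abs_square_eq_1 flip: power2_eq_square)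
  then show ?thesis
    using absv_mult[of "-1" x] by simp
qed

lemma absv_diff_le_max: "absv (x - y) \<le> max (absv x) (absv y)"
  using absv_add_le_max[of x "- y"] by simp

text \<open>Isosceles principle: \<open>y = x - (x - y)\<close>, and \<open>x\<close> is too small
  to account for the size of \<open>y\<close>, so \<open>x - y\<close> must.\<close>

lemma absv_diff_eq_right:
  assumes "absv x < absv y"
  shows "absv (x - y) = absv y"
  using assms absv_diff_le_max[of x y] absv_diff_le_max[of x "x - y"] by auto

lemma absv_power: "absv (x ^ k) = absv x ^ k"
  by (induction k) (simp_all add: absv_mult)

lemma absv_of_nat_le_1: "absv (of_nat k) \<le> 1"
proof (induction k)
  case (Suc k)
  then show ?case
    using absv_add_le_max[of 1 "of_nat k"] by simp
qed simp

lemma absv_sum_less: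
  assumes "finite A" "0 < B" "\<And>i. i \<in> A \<Longrightarrow> absv (g i) < B"
  shows "absv (sum g A) < B"
  using assms
proof (induction A rule: finite_induct)
  case (insert a A)
  then show ?case
    using absv_add_le_max[of "g a" "sum g A"] by fastforce
qed simp

lemma absv_sum_le:
  assumes "finite A" "0 \<le> B" "\<And>i. i \<in> A \<Longrightarrow> absv (g i) \<le> B"
  shows "absv (sum g A) \<le> B"
  using assms
proof (induction A rule: finite_induct)
  case (insert a A)
  then show ?case
    using absv_add_le_max[of "g a" "sum g A"] by fastforce
qed simp

lemma absv_poly_le_1:
  assumes "\<And>k. absv (coeff p k) \<le> 1" "absv z \<le> 1"
  shows "absv (poly p z) \<le> 1"
  unfolding poly_altdef
proof (rule absv_sum_le)
  fix k
  show "absv (coeff p k * z ^ k) \<le> 1"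
    using assms by (simp add: absv_mult absv_power mult_le_one power_le_one absv_nonneg)
qed auto

text \<open>At a root the constant term would be minus the sum of the other terms, which the
  ultrametric inequality makes strictly smaller.\<close>

lemma poly_nonzero_if_const_dominates:
  assumes "\<And>k. 0 < k \<Longrightarrow> k \<le> degree p \<Longrightarrow> absv (coeff p k * x ^ k) < absv (coeff p 0)"
    and "coeff p 0 \<noteq> 0"
  shows "poly p x \<noteq> 0"
proof
  assume "poly p x = 0"
  let ?s = "\<Sum>k\<in>{..degree p} - {0}. coeff p k * x ^ k"
  have "poly p x = coeff p 0 + ?s"
    by (simp add: poly_altdef sum.remove[of "{..degree p}" 0])
  then have "coeff p 0 = - ?s"
    using \<open>poly p x = 0\<close> by (simp add: add_eq_0_iff)
  then have "absv (coeff p 0) = absv ?s"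
    by simp
  moreover have "absv ?s < absv (coeff p 0)"
    using assms by (intro absv_sum_less) (auto intro: absv_pos)
  ultimately show False
    by simp
qed

end

section \<open>Sizes of coefficients and values from the roots, one linear factor at a time\<close>

lemma poly_split_root:
  fixes p :: "'a::field poly"
  assumes "poly p w = 0" "p \<noteq> 0"
  obtains q where "p = [:-w, 1:] * q" "degree p = Suc (degree q)" "lead_coeff q = lead_coeff p"
proof -
  obtain q where p: "p = [:-w, 1:] * q"
    using assms(1) by (auto simp: poly_eq_0_iff_dvd dvd_def)
  then have "q \<noteq> 0"
    using assms(2) by auto
  then have "degree p = Suc (degree q)"
    unfolding p by (subst degree_mult_eq) auto
  moreover have "lead_coeff q = lead_coeff p"
    unfolding p by (subst lead_coeff_mult) simp
  ultimately show ?thesis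
    using p that by blast
qed

locale alg_closed_nonarch_abs = nonarch_abs absv
  for absv :: "'a::alg_closed_field \<Rightarrow> real"
begin

text \<open>Up to sign, the coefficient is the leading one times an elementary symmetric function of
  degree \<open>degree p - k\<close> in the roots. Induction on the degree replaces that
  formula.\<close>

lemma absv_coeff_le:
  assumes "\<And>w. poly p w = 0 \<Longrightarrow> absv w \<le> R" "0 \<le> R" "k \<le> degree p"
  shows "absv (coeff p k) \<le> absv (lead_coeff p) * R ^ (degree p - k)"
  using assms
proof (induction "degree p" arbitrary: p k)
  case (Suc d)
  obtain w where w: "poly p w = 0"
    using Suc.hyps(2) by (metis alg_closed_imp_poly_has_root zero_less_Suc)
  have "p \<noteq> 0"
    using Suc.hyps(2) by auto
  then obtain q where q: "p = [:-w, 1:] * q" "degree p = Suc (degree q)" "lead_coeff q = lead_coeff p"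
    using poly_split_root[OF w] by blast
  have d: "d = degree q"
    using Suc.hyps(2) q(2) by simp
  define L where "L = absv (lead_coeff p)"
  have L: "0 \<le> L"
    by (simp add: L_def absv_nonneg)
  have IH: "absv (coeff q i) \<le> L * R ^ (d - i)" if "i \<le> d" for i
    using Suc.hyps(1)[OF d, of i] Suc.prems(1,2) that d q(1,3) by (simp add: L_def)
  have wR: "absv w \<le> R"
    using Suc.prems(1) w by blast
  have tail: "absv (w * coeff q k) \<le> L * R ^ (Suc d - k)"
  proof (cases "k \<le> d")
    case True
    then have "absv w * absv (coeff q k) \<le> R * (L * R ^ (d - k))"
      using IH wR Suc.prems(2) by (intro mult_mono) (auto simp: absv_nonneg)
    then show ?thesis
      using True by (simp add: absv_mult Suc_diff_le mult_ac)
  next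
    \<comment> \<open>Here \<open>k\<close> exceeds the degree of \<open>q\<close>, so the
      coefficient vanishes.\<close>
    case False
    then show ?thesis
      using d L Suc.prems(2) by (simp add: coeff_eq_0)
  qed
  have "absv (coeff p k) \<le> L * R ^ (Suc d - k)"
  proof (cases k)
    case 0
    then show ?thesis
      using tail q(1) by simp
  next
    case (Suc i)
    then have "coeff p k = coeff q i - w * coeff q k"
      using q(1) by simp
    moreover have "absv (coeff q i) \<le> L * R ^ (Suc d - k)"
      using IH[of i] Suc Suc.prems(3) q(2) d by simp
    ultimately show ?thesis
      using tail absv_diff_le_max[of "coeff q i" "w * coeff q k"] by simp
  qed
  then show ?case
    by (simp add: L_def Suc.hyps(2))
qed simp

text \<open>The value at \<open>z\<close> is the leading coefficient times the product of the
  factors \<open>z - w\<close>, each of size at least \<open>m\<close>.\<close>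

lemma absv_poly_ge:
  assumes "\<And>w. poly p w = 0 \<Longrightarrow> m \<le> absv (z - w)" "0 \<le> m"
  shows "absv (lead_coeff p) * m ^ degree p \<le> absv (poly p z)"
  using assms
proof (induction "degree p" arbitrary: p)
  case 0
  then obtain a where "p = [:a:]"
    by (metis degree_eq_zeroE)
  then show ?case
    by simp
next
  case (Suc d)
  obtain w where w: "poly p w = 0"
    using Suc.hyps(2) by (metis alg_closed_imp_poly_has_root zero_less_Suc)
  have "p \<noteq> 0"
    using Suc.hyps(2) by auto
  then obtain q where q: "p = [:-w, 1:] * q" "degree p = Suc (degree q)" "lead_coeff q = lead_coeff p"
    using poly_split_root[OF w] by blast
  have "absv (lead_coeff q) * m ^ degree q \<le> absv (poly q z)"
    using Suc.hyps Suc.prems q(1,2) by simp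
  moreover have "m \<le> absv (z - w)"
    using Suc.prems(1) w by blast
  ultimately have "m * (absv (lead_coeff q) * m ^ degree q) \<le> absv (z - w) * absv (poly q z)"
    using Suc.prems(2) by (intro mult_mono) (auto simp: absv_nonneg)
  moreover have "poly p z = (z - w) * poly q z"
    unfolding q(1) by (simp add: algebra_simps)
  ultimately show ?case
    unfolding q(3)[symmetric] unfolding q(2) by (simp add: absv_mult mult_ac)
qed

text \<open>Equality case of \<open>absv_poly_ge\<close>: the other factors already contribute at
  least \<open>m\<close> each, so the upper bound on the value leaves at most \<open>m\<close> for
  the factor \<open>z - w\<close>.\<close>

lemma absv_diff_root_le:
  assumes "\<And>w. poly p w = 0 \<Longrightarrow> m \<le> absv (z - w)" "0 < m" "p \<noteq> 0"
    and "absv (poly p z) \<le> absv (lead_coeff p) * m ^ degree p" "poly p w = 0"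
  shows "absv (z - w) \<le> m"
proof -
  obtain q where q: "p = [:-w, 1:] * q" "degree p = Suc (degree q)" "lead_coeff q = lead_coeff p"
    using poly_split_root assms(3,5) by blast
  define C where "C = absv (lead_coeff p) * m ^ degree q"
  have "C \<le> absv (poly q z)"
    using absv_poly_ge[of q m z] assms(1,2) q(1,3) by (simp add: C_def)
  then have "absv (z - w) * C \<le> absv (z - w) * absv (poly q z)"
    by (intro mult_left_mono) (auto simp: absv_nonneg)
  also have "\<dots> = absv (poly p z)"
    unfolding q(1) by (simp add: algebra_simps flip: absv_mult)
  also have "\<dots> \<le> m * C"
    using assms(4) q(2) by (simp add: C_def mult_ac)
  finally have "absv (z - w) * C \<le> m * C" .
  moreover have "0 < C"
    using assms(2,3) by (simp add: C_def absv_pos)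
  ultimately show ?thesis
    by simp
qed

end

section \<open>The polynomial, its derivative and the radius \<open>r\<close>\<close>

locale nonarch_unit_disk_poly = alg_closed_nonarch_abs absv
  for absv :: "'a::{alg_closed_field, field_char_0} \<Rightarrow> real" +
  fixes f :: "'a poly" and n :: nat
  assumes n_ge_2: "n \<ge> 2"
    and degree_f: "degree f = n"
    and monic: "lead_coeff f = 1"
    and zeros_le_1: "poly f z = 0 \<Longrightarrow> absv z \<le> 1"
    and absv_n_less_1: "absv (of_nat n) < 1"
begin

definition r :: real where
  "r = absv (of_nat n) powr (- 1 / (real n - 1))"

lemma absv_n_pos: "0 < absv (of_nat n)"
  using n_ge_2 by (intro absv_pos) simp

lemma r_gt_1: "1 < r"
proof -
  have "1 powr (- 1 / (real n - 1)) < absv (of_nat n) powr (- 1 / (real n - 1))"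
    using n_ge_2 absv_n_pos absv_n_less_1 by (intro powr_less_mono2_neg) auto
  then show ?thesis
    by (simp add: r_def)
qed

lemma r_power: "r ^ k = absv (of_nat n) powr (- (real k / (real n - 1)))"
  using absv_n_pos by (simp add: r_def powr_powr flip: powr_realpow)

text \<open>The left side is the bound of \<open>absv_coeff_le\<close> for coefficient
  \<open>j - 1\<close> of the derivative when its roots have size at most \<open>r\<close>; the
  right side is the form needed for the valuation inequality.\<close>

lemma absv_n_r_power:
  assumes "1 \<le> j" "j \<le> n"
  shows "absv (of_nat n) * r ^ (n - j) = absv (of_nat n) powr ((real j - 1) / (real n - 1))"
proof -
  have "1 + - (real (n - j) / (real n - 1)) = (real j - 1) / (real n - 1)"
    using assms n_ge_2 by (simp add: field_simps of_nat_diff)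
  then show ?thesis
    unfolding r_power using absv_n_pos by (metis powr_add powr_one less_imp_le)
qed

lemma absv_n_r_power_1: "absv (of_nat n) * r ^ (n - 1) = 1"
  using absv_n_r_power[of 1] n_ge_2 absv_n_pos by simp

text \<open>The bound assumed on coefficient \<open>k\<close> of the derivative is calibrated so
  that its term reaches size 1 only at radius \<open>r\<close>.\<close>

lemma absv_n_powr_r_power:
  "absv (of_nat n) powr (real k / (real n - 1)) * r ^ k = 1"
  unfolding r_power using absv_n_pos by (simp flip: powr_add)

lemma degree_deriv: "degree (pderiv f) = n - 1"
  by (simp add: degree_pderiv degree_f)

lemma coeff_deriv: "1 \<le> j \<Longrightarrow> coeff (pderiv f) (j - 1) = of_nat j * coeff f j"
  by (simp add: coeff_pderiv)

lemma lead_coeff_deriv: "lead_coeff (pderiv f) = of_nat n"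
  using coeff_deriv[of n] n_ge_2 monic by (simp add: degree_deriv degree_f)

lemma coeff_deriv_top: "coeff (pderiv f) (n - Suc 0) = of_nat n"
  using lead_coeff_deriv by (simp add: degree_deriv)

lemma deriv_nonzero: "pderiv f \<noteq> 0"
  using degree_deriv n_ge_2 by auto

lemma f_nonzero: "f \<noteq> 0"
  using degree_f n_ge_2 by auto

lemma absv_coeff_le_1: "absv (coeff f k) \<le> 1"
proof (cases "k \<le> n")
  case True
  then show ?thesis
    using absv_coeff_le[of f 1 k] zeros_le_1 by (simp add: degree_f monic[unfolded degree_f])
next
  case False
  then show ?thesis
    by (simp add: coeff_eq_0 degree_f)
qed

lemma absv_deriv_le_1:
  assumes "absv z \<le> 1"
  shows "absv (poly (pderiv f) z) \<le> 1"
proof (rule absv_poly_le_1[OF _ assms])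
  fix k
  show "absv (coeff (pderiv f) k) \<le> 1"
    using absv_of_nat_le_1[of "Suc k"] absv_coeff_le_1[of "Suc k"]
    unfolding coeff_pderiv absv_mult by (intro mult_le_one) (auto simp: absv_nonneg)
qed

section \<open>Distances from zeros to critical points\<close>

abbreviation crit :: "'a set" where
  "crit \<equiv> {w. poly (pderiv f) w = 0}"

definition crit_dist :: "'a \<Rightarrow> real" where
  "crit_dist z = Min ((\<lambda>w. absv (z - w)) ` crit)"

lemma finite_crit: "finite crit"
  using deriv_nonzero by (rule poly_roots_finite)

lemma crit_nonempty: "crit \<noteq> {}"
  using alg_closed_imp_poly_has_root[of "pderiv f"] n_ge_2 degree_deriv by auto

lemma crit_dist_ge_iff: "m \<le> crit_dist z \<longleftrightarrow> (\<forall>w\<in>crit. m \<le> absv (z - w))"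
  using finite_crit crit_nonempty by (simp add: crit_dist_def)

text \<open>With \<open>m\<close> the distance, |n| m^(n-1) \<le> |f'(z)| \<le> 1 = |n|
  r^(n-1).\<close>

lemma crit_dist_le_r:
  assumes "poly f z = 0"
  shows "crit_dist z \<le> r"
proof -
  let ?m = "crit_dist z"
  have ge: "\<And>w. poly (pderiv f) w = 0 \<Longrightarrow> ?m \<le> absv (z - w)"
    using crit_dist_ge_iff[of ?m z] by simp
  have "0 \<le> ?m"
    by (simp add: crit_dist_ge_iff absv_nonneg)
  then have "absv (of_nat n) * ?m ^ (n - 1) \<le> absv (poly (pderiv f) z)"
    using absv_poly_ge[of "pderiv f" ?m z, OF ge] by (simp add: coeff_deriv_top degree_deriv)
  also have "\<dots> \<le> absv (of_nat n) * r ^ (n - 1)"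
    using absv_deriv_le_1 zeros_le_1 assms absv_n_r_power_1 by simp
  finally have "?m ^ (n - 1) \<le> r ^ (n - 1)"
    using absv_n_pos by simp
  then show ?thesis
    using r_gt_1 n_ge_2 by (subst (asm) power_mono_iff) (use \<open>0 \<le> ?m\<close> in auto)
qed

text \<open>No zero has distance above \<open>r\<close>, so the maximum equals \<open>r\<close> as
  soon as one zero reaches it.\<close>

lemma max_min_crit_dist_eq_r_iff:
  "max_min_crit_dist absv f = r \<longleftrightarrow> (\<exists>z. poly f z = 0 \<and> (\<forall>w\<in>crit. r \<le> absv (z - w)))"
proof -
  let ?Z = "{z. poly f z = 0}"
  have fin: "finite (crit_dist ` ?Z)"
    using f_nonzero by (simp add: poly_roots_finite)
  have ne: "crit_dist ` ?Z \<noteq> {}"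
    using alg_closed_imp_poly_has_root[of f] n_ge_2 degree_f by auto
  have "max_min_crit_dist absv f = Max (crit_dist ` ?Z)"
    by (simp add: max_min_crit_dist_def crit_dist_def)
  also have "\<dots> = r \<longleftrightarrow> (\<exists>z\<in>?Z. r \<le> crit_dist z)"
    unfolding Max_eq_iff[OF fin ne] using crit_dist_le_r by (auto intro: antisym)
  finally show ?thesis
    by (simp add: crit_dist_ge_iff)
qed

section \<open>The two implications, in terms of absolute values\<close>

lemma absv_less_r_if_root: "poly f z = 0 \<Longrightarrow> absv z < r"
  using zeros_le_1[of z] r_gt_1 by simp

lemma optimal_imp_coeff_bounds:
  assumes "poly f z = 0" "\<forall>w\<in>crit. r \<le> absv (z - w)"
  shows "absv (coeff f 1) = 1"
    and "1 \<le> j \<Longrightarrow> j \<le> n \<Longrightarrow>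
      absv (of_nat j) * absv (coeff f j) \<le> absv (of_nat n) powr ((real j - 1) / (real n - 1))"
proof -
  have absv_crit: "absv w = r" if "poly (pderiv f) w = 0" for w
  proof -
    \<comment> \<open>Since |f'(z)| \<le> 1 = |n| r^(n-1), the lower bound by the product over
      critical points is attained.\<close>
    have "absv (z - w) \<le> r"
      using assms(2) r_gt_1 deriv_nonzero that absv_deriv_le_1[OF zeros_le_1[OF assms(1)]]
      by (intro absv_diff_root_le[of "pderiv f"])
        (auto simp: coeff_deriv_top degree_deriv absv_n_r_power_1[simplified])
    then have zw: "absv (z - w) = r"
      using assms(2) that by force
    then have "absv (z - (z - w)) = r"
      using absv_diff_eq_right[of z "z - w"] absv_less_r_if_root[OF assms(1)] by simp
    then show ?thesis
      by simp
  qed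
  show "absv (of_nat j) * absv (coeff f j) \<le> absv (of_nat n) powr ((real j - 1) / (real n - 1))"
    if "1 \<le> j" "j \<le> n" for j
    using absv_coeff_le[of "pderiv f" r "j - 1"] absv_crit r_gt_1 that coeff_deriv[of j]
      absv_n_r_power[of j] lead_coeff_deriv by (simp add: degree_deriv absv_mult)
  \<comment> \<open>At 0 the derivative takes the value a_1, while all its roots have distance
    \<open>r\<close> from 0.\<close>
  have "absv (of_nat n) * r ^ (n - 1) \<le> absv (poly (pderiv f) 0)"
    using absv_poly_ge[of "pderiv f" r 0] absv_crit r_gt_1 lead_coeff_deriv
    by (simp add: degree_deriv)
  then have "1 \<le> absv (coeff f 1)"
    by (simp add: absv_n_r_power_1[simplified] poly_0_coeff_0 coeff_pderiv)
  then show "absv (coeff f 1) = 1"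
    using absv_coeff_le_1[of 1] by simp
qed

lemma coeff_bounds_imp_optimal:
  assumes "absv (coeff f 1) = 1"
    and bound: "\<And>j. 2 \<le> j \<Longrightarrow> j \<le> n \<Longrightarrow>
      absv (of_nat j) * absv (coeff f j) \<le> absv (of_nat n) powr ((real j - 1) / (real n - 1))"
    and "poly f z = 0" "w \<in> crit"
  shows "r \<le> absv (z - w)"
proof -
  have "r \<le> absv w"
  proof (rule ccontr)
    assume "\<not> r \<le> absv w"
    have c0: "coeff (pderiv f) 0 = coeff f 1"
      by (simp add: coeff_pderiv)
    have "absv (coeff (pderiv f) k * w ^ k) < absv (coeff (pderiv f) 0)"
      if k: "0 < k" "k \<le> degree (pderiv f)" for k
    proof -
      \<comment> \<open>Coefficient \<open>k\<close> of the derivative comes from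
        \<open>j = k + 1\<close>, which turns (j-1)/(n-1) into k/(n-1).\<close>
      have "absv (coeff (pderiv f) k) \<le> absv (of_nat n) powr (real k / (real n - 1))"
        using bound[of "Suc k"] k degree_deriv coeff_deriv[of "Suc k"] by (simp add: absv_mult)
      then have "absv (coeff (pderiv f) k) * absv w ^ k
          \<le> absv (of_nat n) powr (real k / (real n - 1)) * absv w ^ k"
        by (intro mult_right_mono) (auto simp: absv_nonneg)
      also have "\<dots> < absv (of_nat n) powr (real k / (real n - 1)) * r ^ k"
        using \<open>\<not> r \<le> absv w\<close> absv_nonneg k(1) absv_n_pos
        by (intro mult_strict_left_mono power_strict_mono) auto
      finally show ?thesis
        unfolding absv_n_powr_r_power c0 assms(1) by (simp add: absv_mult absv_power)
    qed
    moreover have "coeff (pderiv f) 0 \<noteq> 0"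
      using c0 assms(1) by auto
    ultimately show False
      using poly_nonzero_if_const_dominates[of "pderiv f" w] assms(4) by auto
  qed
  then show ?thesis
    using absv_diff_eq_right[of z w] absv_less_r_if_root[OF assms(3)] by simp
qed

theorem max_min_crit_dist_eq_r_iff_coeff:
  "max_min_crit_dist absv f = r \<longleftrightarrow>
    (\<forall>j\<in>{2..n}. absv (of_nat j) * absv (coeff f j)
        \<le> absv (of_nat n) powr ((real j - 1) / (real n - 1)))
    \<and> absv (coeff f 1) = 1"
proof -
  obtain z where z: "poly f z = 0"
    using alg_closed_imp_poly_has_root[of f] n_ge_2 degree_f by auto
  show ?thesis (is "_ \<longleftrightarrow> ?bounds")
    unfolding max_min_crit_dist_eq_r_iff
  proof
    assume "\<exists>z. poly f z = 0 \<and> (\<forall>w\<in>crit. r \<le> absv (z - w))"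
    then obtain z where "poly f z = 0" "\<forall>w\<in>crit. r \<le> absv (z - w)"
      by blast
    from optimal_imp_coeff_bounds[OF this] show ?bounds
      by simp
  next
    assume bounds: ?bounds
    \<comment> \<open>Every zero is at distance at least \<open>r\<close> from all critical points,
      so an arbitrary one serves as witness.\<close>
    have "\<forall>w\<in>crit. r \<le> absv (z - w)"
      using coeff_bounds_imp_optimal[OF _ _ z] bounds by simp
    with z show "\<exists>z. poly f z = 0 \<and> (\<forall>w\<in>crit. r \<le> absv (z - w))"
      by blast
  qed
qed

end

section \<open>Translation to valuations\<close>

context nonarch_abs
begin

context
  fixes c v
  assumes c: "1 < c" and v: "\<And>x. v x = (if x = 0 then \<infinity> else ereal (- log c (absv x)))"
begin

lemma valuation_nonneg_iff: "0 \<le> v x \<longleftrightarrow> absv x \<le> 1"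
  using c absv_pos[of x] by (auto simp: v)

lemma valuation_eq_0_iff: "v x = 0 \<longleftrightarrow> absv x = 1"
  using c absv_pos[of x] by (auto simp: v zero_ereal_def log_def)

text \<open>Taking -log to base \<open>c\<close> reverses the order. Nonzero \<open>a\<close> and
  \<open>b\<close> have finite valuations, so the left side never becomes \<infinity> - \<infinity>;
  for \<open>x = 0\<close> both sides are true.\<close>

lemma valuation_ge_iff:
  assumes "a \<noteq> 0" "b \<noteq> 0"
  shows "ereal t * v a - v b \<le> v x \<longleftrightarrow> absv b * absv x \<le> absv a powr t"
proof (cases "x = 0")
  case False
  have "ereal t * v a - v b \<le> v x \<longleftrightarrow> log c (absv b * absv x) \<le> log c (absv a powr t)"
    using c assms False absv_pos[OF assms(1)] absv_pos[OF assms(2)] absv_pos[OF False]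
    by (auto simp: v log_mult log_powr)
  then show ?thesis
    using c assms False absv_pos[OF assms(1)] absv_pos[OF assms(2)] absv_pos[OF False] by simp
qed (simp add: v)

end

end

theorem theorem2:
  fixes absv :: "'a::{alg_closed_field, field_char_0} \<Rightarrow> real"
    and v :: "'a \<Rightarrow> ereal"
    and f :: "'a poly"
    and n :: nat
  assumes "nonarch_abs absv"
    and "valuation_of v absv"
    and "n \<ge> 2"
    and "degree f = n"
    and "lead_coeff f = 1"
    and "\<And>z. poly f z = 0 \<Longrightarrow> absv z \<le> 1"
    and "absv (of_nat n) < 1"
  shows "max_min_crit_dist absv f = absv (of_nat n) powr (- 1 / (real n - 1)) \<longleftrightarrow>
    (\<forall>j\<in>{2..n}. v (coeff f j) \<ge>
        max 0 (ereal ((real j - 1) / (real n - 1)) * v (of_nat n) - v (of_nat j)))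
    \<and> v (coeff f 1) = 0 \<and> v (coeff f 0) \<ge> 0"
proof -
  interpret nonarch_abs absv
    by fact
  interpret nonarch_unit_disk_poly absv f n
    using assms by unfold_locales
  obtain c where c: "1 < c" "\<And>x. v x = (if x = 0 then \<infinity> else ereal (- log c (absv x)))"
    using assms(2) by (auto simp: valuation_of_def)
  \<comment> \<open>The inequality against 0 is integrality of the coefficients; the other one is
    \<open>valuation_ge_iff\<close>, where \<open>n\<close> and \<open>j\<close> are nonzero in
    characteristic 0.\<close>
  have "max 0 (ereal ((real j - 1) / (real n - 1)) * v (of_nat n) - v (of_nat j)) \<le> v (coeff f j)
      \<longleftrightarrow> absv (of_nat j) * absv (coeff f j) \<le> absv (of_nat n) powr ((real j - 1) / (real n - 1))"
    if "j \<in> {2..n}" for j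
    using that n_ge_2 absv_coeff_le_1[of j]
    by (simp add: valuation_nonneg_iff[OF c] valuation_ge_iff[OF c])
  then show ?thesis
    using max_min_crit_dist_eq_r_iff_coeff absv_coeff_le_1[of 0]
    by (simp add: r_def valuation_nonneg_iff[OF c] valuation_eq_0_iff[OF c])
qed

end
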